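(* Let $K$ be a knot type and $D$ a geometric size functional. Assume that $\rho_D(K)>0$ and $\operatorname{CRad}_D(K)>0$. Then $$\operatorname{Rop}(K)=\rho_D(K)\operatorname{CRad}_D(K)$$ holds if and only if there exists a sequence $\gamma_j\in\mathcal H(K)$ such that $$\operatorname{Rop}(\gamma_j)\to\operatorname{Rop}(K),\qquad \rho_D(\gamma_j)\to\rho_D(K),\qquad \operatorname{CRad}_D(\gamma_j)\to\operatorname{CRad}_D(K).$$ In particular, if all three infima $\operatorname{Rop}(K)$, $\rho_D(K)$, $\operatorname{CRad}_D(K)$ are attained, then equality holds if and only if there is a common minimizer, i.e. a single $\gamma\in\mathcal H(K)$ attaining all three.
   Context: Curves are in $\mathbb R^3$. For a knot type $K$, $\mathcal H(K)$ is the set of $C^{1,1}$ embedded closed curves representing $K$ and having positive thickness (admissible representatives). $\operatorname{Len}$ is length, and the thickness $\operatorname{Thi}(\gamma)$ is the tube radius: the supremum of $r>0$ such that the open disks of radius $r$ centred at the points of $\gamma$ in the planes normal to $\gamma$ are pairwise disjoint. A geometric size functional $D$ assigns to each admissible embedded closed curve a real number $D(\gamma)$ with $D(g\gamma)=D(\gamma)$ for every Euclidean isometry $g$ of $\mathbb R^3$, $D(a\gamma)=aD(\gamma)$ for every $a>0$, and $D(\gamma)>0$. For $\gamma\in\mathcal H(K)$: ropelength $\operatorname{Rop}(\gamma)=\operatorname{Len}(\gamma)/\operatorname{Thi}(\gamma)$, $D$-density $\rho_D(\gamma)=\operatorname{Len}(\gamma)/D(\gamma)$, $D$-compression radius $\operatorname{CRad}_D(\gamma)=D(\gamma)/\operatorname{Thi}(\gamma)$.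 The invariants $\operatorname{Rop}(K)$, $\rho_D(K)$, $\operatorname{CRad}_D(K)$ are the infima of these quantities over $\gamma\in\mathcal H(K)$. *)

theory Defs
  imports "HOL-Analysis.Analysis"
begin

type_synonym R3 = "real ^ 3"

section \<open>Closed curves\<close>

text \<open>A closed curve is a map from the circle \<open>\<real>/\<int>\<close>, given as a
  1-periodic function on \<open>\<real>\<close>. Periodicity makes differentiability at the seam
  automatic and leaves no values outside a fundamental domain unspecified.\<close>

definition embedded_closed_curve :: "(real \<Rightarrow> R3) \<Rightarrow> bool" where
  "embedded_closed_curve \<gamma> \<longleftrightarrow>
     continuous_on UNIV \<gamma> \<and> (\<forall>t. \<gamma> (t + 1) = \<gamma> t) \<and> inj_on \<gamma> {0..<1}"

definition tangent :: "(real \<Rightarrow> R3) \<Rightarrow> real \<Rightarrow> R3" where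
  "tangent \<gamma> t = vector_derivative \<gamma> (at t)"

text \<open>An embedding of class \<open>C\<^sup>1\<^sup>,\<^sup>1\<close> is in particular an immersion, hence the
  non-vanishing of the derivative.\<close>

definition C11_embedded_closed_curve :: "(real \<Rightarrow> R3) \<Rightarrow> bool" where
  "C11_embedded_closed_curve \<gamma> \<longleftrightarrow>
     embedded_closed_curve \<gamma> \<and>
     (\<forall>t. \<gamma> differentiable (at t)) \<and>
     (\<exists>L. L-lipschitz_on UNIV (tangent \<gamma>)) \<and>
     (\<forall>t. tangent \<gamma> t \<noteq> 0)"

definition Len :: "(real \<Rightarrow> R3) \<Rightarrow> real" where
  "Len \<gamma> = integral {0..1} (\<lambda>t. norm (tangent \<gamma> t))"

definition normal_disk :: "(real \<Rightarrow> R3) \<Rightarrow> real \<Rightarrow> real \<Rightarrow> R3 set" where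
  "normal_disk \<gamma> r t = {x. dist x (\<gamma> t) < r \<and> (x - \<gamma> t) \<bullet> tangent \<gamma> t = 0}"

text \<open>The radius \<open>r = 0\<close>, for which the disks are empty, is admitted only so that the
  supremum is 0 when no positive radius works; otherwise it does not affect the value.
  For a \<open>C\<^sup>1\<^sup>,\<^sup>1\<close> embedded closed curve the set of radii is bounded, because two of
  the normal planes are not parallel.\<close>

definition Thi :: "(real \<Rightarrow> R3) \<Rightarrow> real" where
  "Thi \<gamma> = Sup {r. 0 \<le> r \<and> disjoint_family_on (normal_disk \<gamma> r) {0..<1}}"

definition admissible :: "(real \<Rightarrow> R3) \<Rightarrow> bool" where
  "admissible \<gamma> \<longleftrightarrow> C11_embedded_closed_curve \<gamma> \<and> Thi \<gamma> > 0"

section \<open>Knot types\<close>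

definition ambient_isotopic :: "(real \<Rightarrow> R3) \<Rightarrow> (real \<Rightarrow> R3) \<Rightarrow> bool" where
  "ambient_isotopic \<gamma> \<eta> \<longleftrightarrow>
     (\<exists>h. homotopic_with_canon (\<lambda>f. \<exists>g. homeomorphism UNIV UNIV f g) UNIV UNIV id h \<and>
          h ` range \<gamma> = range \<eta>)"

text \<open>Knot types are the (unoriented) ambient isotopy classes of tame embedded closed
  curves; tame classes are exactly those containing a \<open>C\<^sup>1\<^sup>,\<^sup>1\<close> curve.\<close>

definition knot_type :: "(real \<Rightarrow> R3) set \<Rightarrow> bool" where
  "knot_type K \<longleftrightarrow>
     (\<exists>\<gamma>. C11_embedded_closed_curve \<gamma> \<and>
          K = {\<eta>. embedded_closed_curve \<eta> \<and> ambient_isotopic \<gamma> \<eta>})"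

definition admissible_reps :: "(real \<Rightarrow> R3) set \<Rightarrow> (real \<Rightarrow> R3) set" where
  "admissible_reps K = {\<gamma> \<in> K. admissible \<gamma>}"

section \<open>Size functionals and the associated quantities\<close>

text \<open>Invariance under reparametrization is not required: a functional of unparametrized
  curves is the special case of a \<open>D\<close> depending on the image of the curve only.\<close>

definition geometric_size_functional :: "((real \<Rightarrow> R3) \<Rightarrow> real) \<Rightarrow> bool" where
  "geometric_size_functional D \<longleftrightarrow>
     (\<forall>\<gamma>. admissible \<gamma> \<longrightarrow>
        (\<forall>g. (\<forall>x y. dist (g x) (g y) = dist x y) \<longrightarrow> D (g \<circ> \<gamma>) = D \<gamma>) \<and>
        (\<forall>a>0. D (\<lambda>t. a *\<^sub>R \<gamma> t) = a * D \<gamma>) \<and>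
        D \<gamma> > 0)"

definition Rop :: "(real \<Rightarrow> R3) \<Rightarrow> real" where
  "Rop \<gamma> = Len \<gamma> / Thi \<gamma>"

definition rho :: "((real \<Rightarrow> R3) \<Rightarrow> real) \<Rightarrow> (real \<Rightarrow> R3) \<Rightarrow> real" where
  "rho D \<gamma> = Len \<gamma> / D \<gamma>"

definition CRad :: "((real \<Rightarrow> R3) \<Rightarrow> real) \<Rightarrow> (real \<Rightarrow> R3) \<Rightarrow> real" where
  "CRad D \<gamma> = D \<gamma> / Thi \<gamma>"

definition Rop_knot :: "(real \<Rightarrow> R3) set \<Rightarrow> real" where
  "Rop_knot K = (INF \<gamma>\<in>admissible_reps K. Rop \<gamma>)"

definition rho_knot :: "((real \<Rightarrow> R3) \<Rightarrow> real) \<Rightarrow> (real \<Rightarrow> R3) set \<Rightarrow> real" where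
  "rho_knot D K = (INF \<gamma>\<in>admissible_reps K. rho D \<gamma>)"

definition CRad_knot :: "((real \<Rightarrow> R3) \<Rightarrow> real) \<Rightarrow> (real \<Rightarrow> R3) set \<Rightarrow> real" where
  "CRad_knot D K = (INF \<gamma>\<in>admissible_reps K. CRad D \<gamma>)"

end

theory Submission
  imports Defs
begin

text \<open>The identity \<open>Rop = \<rho>\<^sub>D \<cdot> CRad\<^sub>D\<close> holds curve by curve, and each factor is bounded
  below by its positive infimum. If the infima multiply, then along a sequence minimizing
  the ropelength each factor is squeezed to its own infimum; the converse is continuity of
  the product.

  The infima only make sense once \<open>\<H>(K)\<close> is known to be nonempty, so the thickness of an
  embedded \<open>C\<^sup>1\<^sup>,\<^sup>1\<close> closed curve has to be shown positive. Nearby normal disks of small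
  radius are disjoint by the Lipschitz bound on the tangent, and disks at distant
  parameters are disjoint because distant points of the curve are uniformly separated.
  The radii are bounded because Rolle's theorem yields two orthogonal tangents,
  whose normal planes meet.\<close>

section \<open>Positivity of the thickness\<close>

lemma tangent_has_vector_derivative:
  assumes "C11_embedded_closed_curve \<gamma>"
  shows "(\<gamma> has_vector_derivative tangent \<gamma> t) (at t)"
  using assms vector_derivative_works
  unfolding C11_embedded_closed_curve_def tangent_def by blast

text \<open>The mean value theorem is for real functions, so the curve is studied through its height
  in a fixed direction \<open>v\<close>.\<close>

lemma inner_has_real_derivative:
  assumes "C11_embedded_closed_curve \<gamma>"
  shows "((\<lambda>u. \<gamma> u \<bullet> v) has_real_derivative tangent \<gamma> t \<bullet> v) (at t)"
proof -
  have "(\<gamma> has_derivative (\<lambda>h. h *\<^sub>R tangent \<gamma> t)) (at t)"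
    using tangent_has_vector_derivative[OF assms] by (simp add: has_vector_derivative_def)
  then have "((\<lambda>u. \<gamma> u \<bullet> v) has_derivative (\<lambda>h. (h *\<^sub>R tangent \<gamma> t) \<bullet> v)) (at t)"
    by (rule has_derivative_inner_left)
  then show ?thesis
    by (simp add: has_field_derivative_def mult.commute[of _ "tangent \<gamma> t \<bullet> v"])
qed

lemma continuous_on_tangent:
  assumes "C11_embedded_closed_curve \<gamma>"
  shows "continuous_on S (tangent \<gamma>)"
  using assms lipschitz_on_continuous_on continuous_on_subset
  unfolding C11_embedded_closed_curve_def by blast

lemma tangent_periodic:
  assumes "C11_embedded_closed_curve \<gamma>"
  shows "tangent \<gamma> (t + 1) = tangent \<gamma> t"
proof -
  have eq: "(\<gamma> \<circ> (\<lambda>u. u + 1)) = \<gamma>"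
    using assms by (auto simp: C11_embedded_closed_curve_def embedded_closed_curve_def)
  have "((\<lambda>u::real. u + 1) has_vector_derivative 1) (at t)"
    by (auto intro!: derivative_eq_intros)
  from vector_diff_chain_at[OF this tangent_has_vector_derivative[OF assms]]
  have "(\<gamma> has_vector_derivative tangent \<gamma> (t + 1)) (at t)"
    by (simp add: eq)
  then show ?thesis
    using tangent_has_vector_derivative[OF assms] vector_derivative_unique_at by blast
qed

text \<open>Lets a disk near one side of the seam be compared with disks near the other by a shift
  of one period.\<close>

lemma normal_disk_periodic:
  assumes "C11_embedded_closed_curve \<gamma>"
  shows "normal_disk \<gamma> r (t + 1) = normal_disk \<gamma> r t"
  using assms tangent_periodic[OF assms]
  by (simp add: normal_disk_def C11_embedded_closed_curve_def embedded_closed_curve_def)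

lemma tangent_norm_lower_bound:
  assumes "C11_embedded_closed_curve \<gamma>"
  obtains m where "m > 0" "\<And>t. t \<in> {0..1} \<Longrightarrow> m \<le> norm (tangent \<gamma> t)"
proof -
  have "continuous_on {0..1} (\<lambda>t. norm (tangent \<gamma> t))"
    using continuous_on_tangent[OF assms] by (intro continuous_on_norm)
  then obtain t0 where "\<forall>t\<in>{0..1}. norm (tangent \<gamma> t0) \<le> norm (tangent \<gamma> t)"
    using continuous_attains_inf[of "{0..1::real}"]
    by (metis atLeastAtMost_iff compact_Icc empty_iff zero_le_one order_refl)
  moreover have "norm (tangent \<gamma> t0) > 0"
    using assms by (simp add: C11_embedded_closed_curve_def)
  ultimately show ?thesis using that by blast
qed

text \<open>A common point \<open>x\<close> of two disks gives \<open>(\<gamma> t - \<gamma> s)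
  \<bullet> v = (x - \<gamma> s) \<bullet> (v - tangent \<gamma> s)\<close> with
  \<open>v = tangent \<gamma> t\<close>. The left side has size at least
  \<open>\<bar>t - s\<bar> * m\<^sup>2 / 2\<close>, while the right side is smaller than
  \<open>r * L * \<bar>t - s\<bar>\<close>. Only \<open>t\<close> is confined to the unit interval,
  so that \<open>s\<close> may lie beyond the seam.\<close>

lemma normal_disks_disjoint_near:
  assumes c: "C11_embedded_closed_curve \<gamma>"
  obtains \<delta> r where "\<delta> > 0" "r > 0"
    "\<And>s t. t \<in> {0..1} \<Longrightarrow> s \<noteq> t \<Longrightarrow> \<bar>s - t\<bar> < \<delta> \<Longrightarrow> normal_disk \<gamma> r s \<inter> normal_disk \<gamma> r t = {}"
proof -
  obtain m where m: "m > 0" "\<And>t. t \<in> {0..1} \<Longrightarrow> m \<le> norm (tangent \<gamma> t)"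
    using tangent_norm_lower_bound[OF c] by blast
  obtain L0 where "L0-lipschitz_on UNIV (tangent \<gamma>)"
    using c unfolding C11_embedded_closed_curve_def by blast
  \<comment> \<open>A strictly positive Lipschitz constant, by which one may divide.\<close>
  define L where "L = \<bar>L0\<bar> + 1"
  have L: "L > 0" and lip: "norm (tangent \<gamma> s - tangent \<gamma> t) \<le> L * \<bar>s - t\<bar>" for s t
  proof -
    show "L > 0" unfolding L_def by simp
    have "norm (tangent \<gamma> s - tangent \<gamma> t) \<le> L0 * \<bar>s - t\<bar>"
      using lipschitz_onD[OF \<open>L0-lipschitz_on UNIV (tangent \<gamma>)\<close>, of s t]
      by (simp add: dist_norm)
    also have "\<dots> \<le> L * \<bar>s - t\<bar>"
      unfolding L_def by (intro mult_right_mono) auto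
    finally show "norm (tangent \<gamma> s - tangent \<gamma> t) \<le> L * \<bar>s - t\<bar>" .
  qed
  \<comment> \<open>Within \<open>\<delta>\<close> the tangent changes by at most
    \<open>m / 2\<close>, and \<open>r * L\<close> is exactly the lower bound
    \<open>m\<^sup>2 / 2\<close> found below.\<close>
  define \<delta> where "\<delta> = m / (2 * L)"
  define r where "r = m\<^sup>2 / (2 * L)"
  have "normal_disk \<gamma> r s \<inter> normal_disk \<gamma> r t = {}"
    if t: "t \<in> {0..1}" and st: "s \<noteq> t" "\<bar>s - t\<bar> < \<delta>" for s t
  proof (rule ccontr)
    assume "normal_disk \<gamma> r s \<inter> normal_disk \<gamma> r t \<noteq> {}"
    then obtain x where x: "norm (x - \<gamma> s) < r" "(x - \<gamma> s) \<bullet> tangent \<gamma> s = 0"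
      "(x - \<gamma> t) \<bullet> tangent \<gamma> t = 0"
      by (auto simp: normal_disk_def dist_norm)
    define v where "v = tangent \<gamma> t"
    have mv: "m \<le> norm v" unfolding v_def using m t by blast
    have "\<exists>\<xi>. \<bar>\<xi> - t\<bar> < \<delta> \<and> \<gamma> t \<bullet> v - \<gamma> s \<bullet> v = (t - s) * (tangent \<gamma> \<xi> \<bullet> v)"
    proof (cases "s < t")
      case True
      with MVT2[of s t "\<lambda>u. \<gamma> u \<bullet> v" "\<lambda>u. tangent \<gamma> u \<bullet> v"] inner_has_real_derivative[OF c]
      obtain \<xi> where "s < \<xi>" "\<xi> < t" "\<gamma> t \<bullet> v - \<gamma> s \<bullet> v = (t - s) * (tangent \<gamma> \<xi> \<bullet> v)"
        by blast
      with st show ?thesis by (intro exI[of _ \<xi>]) auto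
    next
      case False
      with st have "t < s" by simp
      with MVT2[of t s "\<lambda>u. \<gamma> u \<bullet> v" "\<lambda>u. tangent \<gamma> u \<bullet> v"] inner_has_real_derivative[OF c]
      obtain \<xi> where "t < \<xi>" "\<xi> < s" "\<gamma> s \<bullet> v - \<gamma> t \<bullet> v = (s - t) * (tangent \<gamma> \<xi> \<bullet> v)"
        by blast
      with st show ?thesis by (intro exI[of _ \<xi>]) (auto simp: algebra_simps)
    qed
    then obtain \<xi> where \<xi>: "\<bar>\<xi> - t\<bar> < \<delta>"
      "\<gamma> t \<bullet> v - \<gamma> s \<bullet> v = (t - s) * (tangent \<gamma> \<xi> \<bullet> v)" by blast
    have "norm (v - tangent \<gamma> \<xi>) \<le> L * \<bar>\<xi> - t\<bar>"
      using lip[of t \<xi>] by (simp add: v_def abs_minus_commute)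
    also have "\<dots> \<le> L * \<delta>" using \<xi>(1) L by simp
    also have "\<dots> = m / 2" using L by (simp add: \<delta>_def)
    finally have small: "norm (v - tangent \<gamma> \<xi>) \<le> norm v / 2" using mv by simp
    have "(v - tangent \<gamma> \<xi>) \<bullet> v \<le> norm (v - tangent \<gamma> \<xi>) * norm v"
      by (rule norm_cauchy_schwarz)
    also have "\<dots> \<le> norm v / 2 * norm v"
      using small by (intro mult_right_mono) auto
    finally have "(norm v)\<^sup>2 / 2 \<le> tangent \<gamma> \<xi> \<bullet> v"
      by (simp add: inner_diff_left power2_eq_square dot_square_norm)
    moreover have "m\<^sup>2 \<le> (norm v)\<^sup>2" using mv m by (intro power_mono) auto
    ultimately have low: "m\<^sup>2 / 2 \<le> \<bar>tangent \<gamma> \<xi> \<bullet> v\<bar>" by linarith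
    \<comment> \<open>Orthogonality at \<open>t\<close> replaces \<open>\<gamma> t\<close> by
      \<open>x\<close>; orthogonality at \<open>s\<close> allows \<open>tangent \<gamma> s\<close>
      to be subtracted, which makes the second factor Lipschitz-small.\<close>
    have "(t - s) * (tangent \<gamma> \<xi> \<bullet> v) = (x - \<gamma> s) \<bullet> (v - tangent \<gamma> s)"
      using \<xi>(2) x(2,3) by (simp add: v_def inner_diff_left inner_diff_right)
    then have "\<bar>t - s\<bar> * \<bar>tangent \<gamma> \<xi> \<bullet> v\<bar> \<le> norm (x - \<gamma> s) * norm (v - tangent \<gamma> s)"
      by (metis Cauchy_Schwarz_ineq2 abs_mult)
    also have "\<dots> \<le> norm (x - \<gamma> s) * (L * \<bar>t - s\<bar>)"
      unfolding v_def by (intro mult_left_mono lip) auto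
    also have "\<dots> < r * (L * \<bar>t - s\<bar>)"
      using x(1) L st by (intro mult_strict_right_mono) auto
    also have "\<dots> = \<bar>t - s\<bar> * (m\<^sup>2 / 2)" using L by (simp add: r_def)
    also have "\<dots> \<le> \<bar>t - s\<bar> * \<bar>tangent \<gamma> \<xi> \<bullet> v\<bar>"
      using low by (intro mult_left_mono) auto
    finally show False by simp
  qed
  moreover have "\<delta> > 0" "r > 0" using m L by (auto simp: \<delta>_def r_def)
  ultimately show ?thesis using that by blast
qed

text \<open>The distance is continuous and positive on the compact set of parameter pairs at circle
  distance at least \<open>\<delta>\<close>. The bound \<open>1 - \<delta>\<close> removes pairs
  that are close across the seam.\<close>

lemma embedded_closed_curve_separation:
  assumes "embedded_closed_curve \<gamma>" "\<delta> > 0"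
  obtains d where "d > 0"
    "\<And>s t. \<lbrakk>s \<in> {0..1}; t \<in> {0..1}; \<delta> \<le> \<bar>s - t\<bar>; \<bar>s - t\<bar> \<le> 1 - \<delta>\<rbrakk> \<Longrightarrow> d \<le> dist (\<gamma> s) (\<gamma> t)"
proof -
  define C where "C = ({0..1} \<times> {0..1}) \<inter>
    ({p::real \<times> real. \<delta> \<le> \<bar>fst p - snd p\<bar>} \<inter> {p. \<bar>fst p - snd p\<bar> \<le> 1 - \<delta>})"
  have cont: "continuous_on UNIV \<gamma>" and per: "\<And>t. \<gamma> (t + 1) = \<gamma> t"
    and inj: "inj_on \<gamma> {0..<1}"
    using assms(1) by (auto simp: embedded_closed_curve_def)
  have "compact C" unfolding C_def
    by (intro compact_Int_closed compact_Times compact_Icc closed_Int closed_Collect_le continuous_intros)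
  have "\<gamma> 1 = \<gamma> 0" using per[of 0] by simp
  have ne: "\<gamma> (fst p) \<noteq> \<gamma> (snd p)" if "p \<in> C" for p
  proof
    assume eq: "\<gamma> (fst p) = \<gamma> (snd p)"
    \<comment> \<open>Folds the endpoint 1 onto 0, where injectivity on the half-open interval
      applies. Pairs identified by \<open>w\<close> differ by 0 or 1, and both differences are
      excluded in \<open>C\<close>.\<close>
    define w where "w u = (if u = 1 then 0 else u)" for u :: real
    have "\<gamma> (w (fst p)) = \<gamma> (w (snd p))"
      using eq \<open>\<gamma> 1 = \<gamma> 0\<close> by (cases "fst p = 1"; cases "snd p = 1"; simp add: w_def)
    moreover have "w (fst p) \<in> {0..<1}" "w (snd p) \<in> {0..<1}"
      using that by (auto simp: C_def w_def)
    ultimately have "w (fst p) = w (snd p)" using inj by (meson inj_onD)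
    then show False using that assms(2) by (auto simp: C_def w_def split: if_splits)
  qed
  have "\<exists>d>0. \<forall>p\<in>C. d \<le> dist (\<gamma> (fst p)) (\<gamma> (snd p))"
  proof (cases "C = {}")
    \<comment> \<open>This happens when \<open>\<delta> > 1/2\<close>; any positive constant then
      serves.\<close>
    case True
    then show ?thesis by (auto intro: exI[of _ 1])
  next
    case False
    have "continuous_on C (\<lambda>p. dist (\<gamma> (fst p)) (\<gamma> (snd p)))"
      by (intro continuous_intros continuous_on_compose2[OF cont]) auto
    then obtain p where "p \<in> C"
      "\<forall>q\<in>C. dist (\<gamma> (fst p)) (\<gamma> (snd p)) \<le> dist (\<gamma> (fst q)) (\<gamma> (snd q))"
      using continuous_attains_inf[OF \<open>compact C\<close> False] by blast
    with ne[of p] show ?thesis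
      by (intro exI[of _ "dist (\<gamma> (fst p)) (\<gamma> (snd p))"]) auto
  qed
  then obtain d where "d > 0" and d: "\<forall>p\<in>C. d \<le> dist (\<gamma> (fst p)) (\<gamma> (snd p))" by blast
  have "d \<le> dist (\<gamma> s) (\<gamma> t)" if "(s, t) \<in> C" for s t
    using bspec[OF d that] by simp
  with \<open>d > 0\<close> show ?thesis by (intro that[of d]) (auto simp: C_def)
qed

lemma normal_disk_mono: "r \<le> r' \<Longrightarrow> normal_disk \<gamma> r t \<subseteq> normal_disk \<gamma> r' t"
  by (auto simp: normal_disk_def)

text \<open>Two parameters on the circle are close directly, close across the seam, or far apart;
  the first two cases use the local estimate and the third the separation of the curve.\<close>

lemma ex_disjoint_normal_disks:
  assumes c: "C11_embedded_closed_curve \<gamma>"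
  obtains r where "r > 0" "disjoint_family_on (normal_disk \<gamma> r) {0..<1}"
proof -
  obtain \<delta> r1 where \<delta>: "\<delta> > 0" "r1 > 0" and
    near: "\<And>s t. t \<in> {0..1} \<Longrightarrow> s \<noteq> t \<Longrightarrow> \<bar>s - t\<bar> < \<delta> \<Longrightarrow>
      normal_disk \<gamma> r1 s \<inter> normal_disk \<gamma> r1 t = {}"
    using normal_disks_disjoint_near[OF c] by blast
  obtain d where d: "d > 0" and
    far: "\<And>s t. \<lbrakk>s \<in> {0..1}; t \<in> {0..1}; \<delta> \<le> \<bar>s - t\<bar>; \<bar>s - t\<bar> \<le> 1 - \<delta>\<rbrakk>
      \<Longrightarrow> d \<le> dist (\<gamma> s) (\<gamma> t)"
    using embedded_closed_curve_separation c \<delta>(1) unfolding C11_embedded_closed_curve_def by blast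
  define r where "r = min r1 (d / 2)"
  have disj: "normal_disk \<gamma> r s \<inter> normal_disk \<gamma> r t = {}"
    if st: "s \<in> {0..<1}" "t \<in> {0..<1}" "s < t" for s t
  proof -
    have sub: "normal_disk \<gamma> r u \<subseteq> normal_disk \<gamma> r1 u" for u
      by (rule normal_disk_mono) (simp add: r_def)
    consider "t - s < \<delta>" | "t - s > 1 - \<delta>" | "\<delta> \<le> \<bar>s - t\<bar>" "\<bar>s - t\<bar> \<le> 1 - \<delta>"
      using st by linarith
    then show ?thesis
    proof cases
      case 1
      then have "normal_disk \<gamma> r1 s \<inter> normal_disk \<gamma> r1 t = {}"
        using st by (intro near) auto
      then show ?thesis using sub[of s] sub[of t] by blast
    next
      case 2
      \<comment> \<open>The shifted parameter satisfies
        \<open>0 < s + 1 - t < \<delta>\<close>.\<close>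
      then have "normal_disk \<gamma> r1 (s + 1) \<inter> normal_disk \<gamma> r1 t = {}"
        using st by (intro near) auto
      then show ?thesis
        using sub[of s] sub[of t] by (auto simp: normal_disk_periodic[OF c])
    next
      case 3
      then have "d \<le> dist (\<gamma> s) (\<gamma> t)"
        using st by (intro far) auto
      have False if "x \<in> normal_disk \<gamma> r s" "x \<in> normal_disk \<gamma> r t" for x
      proof -
        have "dist x (\<gamma> s) < d / 2" "dist x (\<gamma> t) < d / 2"
          using that by (simp_all add: normal_disk_def r_def)
        then have "dist (\<gamma> s) (\<gamma> t) < d" by (rule dist_triangle_half_r)
        with \<open>d \<le> dist (\<gamma> s) (\<gamma> t)\<close> show False by simp
      qed
      then show ?thesis by blast
    qed
  qed
  have "disjoint_family_on (normal_disk \<gamma> r) {0..<1}"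
    unfolding disjoint_family_on_def
    using disj by (metis Int_commute linorder_less_linear)
  moreover have "r > 0" using \<delta> d by (simp add: r_def)
  ultimately show ?thesis using that by blast
qed

text \<open>The height in direction \<open>tangent \<gamma> 0\<close> has equal values at 0 and 1,
  so it is stationary at some \<open>\<xi>\<close>, where the tangent is orthogonal to the initial
  one. The two normal planes then meet, and a point of the intersection bounds the radii.\<close>

lemma bdd_above_disjoint_radii:
  assumes c: "C11_embedded_closed_curve \<gamma>"
  shows "bdd_above {r. 0 \<le> r \<and> disjoint_family_on (normal_disk \<gamma> r) {0..<1}}"
proof -
  define v where "v = tangent \<gamma> 0"
  have "\<gamma> 1 = \<gamma> 0"
    using c by (metis C11_embedded_closed_curve_def embedded_closed_curve_def add_0)
  obtain \<xi> where \<xi>: "0 < \<xi>" "\<xi> < 1" "\<gamma> 1 \<bullet> v - \<gamma> 0 \<bullet> v = (1 - 0) * (tangent \<gamma> \<xi> \<bullet> v)"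
    using MVT2[of 0 1 "\<lambda>u. \<gamma> u \<bullet> v" "\<lambda>u. tangent \<gamma> u \<bullet> v"] inner_has_real_derivative[OF c]
    by (metis zero_less_one)
  define w where "w = tangent \<gamma> \<xi>"
  have orth: "w \<bullet> v = 0" using \<xi>(3) \<open>\<gamma> 1 = \<gamma> 0\<close> by (simp add: w_def)
  have "w \<noteq> 0" using c by (simp add: w_def C11_embedded_closed_curve_def)
  \<comment> \<open>Moving along \<open>w\<close> stays in the normal plane at 0, since
    \<open>w\<close> is orthogonal to \<open>v\<close>; the coefficient is chosen to reach the
    normal plane at \<open>\<xi>\<close>.\<close>
  define x where "x = \<gamma> 0 + (((\<gamma> \<xi> - \<gamma> 0) \<bullet> w) / (w \<bullet> w)) *\<^sub>R w"
  have "(x - \<gamma> 0) \<bullet> v = 0" by (simp add: x_def orth)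
  moreover have "(x - \<gamma> \<xi>) \<bullet> w = 0"
    using \<open>w \<noteq> 0\<close> by (simp add: x_def inner_diff_left inner_add_left)
  ultimately have x: "x \<in> normal_disk \<gamma> r 0 \<inter> normal_disk \<gamma> r \<xi>"
    if "dist x (\<gamma> 0) < r" "dist x (\<gamma> \<xi>) < r" for r
    using that by (simp add: normal_disk_def v_def w_def)
  show ?thesis
  proof (rule bdd_aboveI)
    fix r assume "r \<in> {r. 0 \<le> r \<and> disjoint_family_on (normal_disk \<gamma> r) {0..<1}}"
    then have "normal_disk \<gamma> r 0 \<inter> normal_disk \<gamma> r \<xi> = {}"
      using \<xi> by (auto simp: disjoint_family_on_def)
    then show "r \<le> max (dist x (\<gamma> 0)) (dist x (\<gamma> \<xi>))"
      using x[of r] by fastforce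
  qed
qed

text \<open>A positive radius bounds the real supremum \<open>Thi\<close> from below because the set
  of radii is bounded above.\<close>

lemma C11_embedded_closed_curve_imp_admissible:
  assumes c: "C11_embedded_closed_curve \<gamma>"
  shows "admissible \<gamma>"
proof -
  obtain r where r: "r > 0" "disjoint_family_on (normal_disk \<gamma> r) {0..<1}"
    using ex_disjoint_normal_disks[OF c] .
  then have "r \<le> Thi \<gamma>"
    unfolding Thi_def by (intro cSup_upper bdd_above_disjoint_radii[OF c]) auto
  with r c show ?thesis by (simp add: admissible_def)
qed

section \<open>Existence of admissible representatives\<close>

lemma ambient_isotopic_refl: "ambient_isotopic \<gamma> \<gamma>"
proof -
  have "homeomorphism (UNIV :: R3 set) UNIV id id"
    by (simp add: homeomorphism_def)
  then have "homotopic_with_canon (\<lambda>f::R3 \<Rightarrow> R3. \<exists>g. homeomorphism UNIV UNIV f g) UNIV UNIV id id"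
    by (subst homotopic_with_refl) auto
  then show ?thesis unfolding ambient_isotopic_def by (intro exI[of _ id]) simp
qed

text \<open>The curve that generates the class is itself admissible.\<close>

lemma admissible_reps_nonempty:
  assumes "knot_type K"
  shows "admissible_reps K \<noteq> {}"
proof -
  obtain \<gamma> where "C11_embedded_closed_curve \<gamma>"
    "K = {\<eta>. embedded_closed_curve \<eta> \<and> ambient_isotopic \<gamma> \<eta>}"
    using assms unfolding knot_type_def by blast
  then have "\<gamma> \<in> admissible_reps K"
    using C11_embedded_closed_curve_imp_admissible ambient_isotopic_refl
    by (auto simp: admissible_reps_def C11_embedded_closed_curve_def)
  then show ?thesis by blast
qed

section \<open>Infima of products\<close>

lemma minimizing_sequence:
  fixes f :: "'a \<Rightarrow> real"
  assumes "S \<noteq> {}" "bdd_below (f ` S)"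
  obtains x :: "nat \<Rightarrow> 'a" where "\<And>j. x j \<in> S" "(\<lambda>j. f (x j)) \<longlonglongrightarrow> (INF a\<in>S. f a)"
proof -
  have "\<exists>a\<in>S. f a < (INF a\<in>S. f a) + inverse (real (Suc j))" for j
    using assms by (subst cINF_less_iff[symmetric]) auto
  then obtain x where x: "\<And>j. x j \<in> S"
    "\<And>j. f (x j) < (INF a\<in>S. f a) + inverse (real (Suc j))"
    by metis
  have "(\<lambda>j. f (x j)) \<longlonglongrightarrow> (INF a\<in>S. f a)"
  proof (rule tendsto_sandwich[OF _ _ tendsto_const LIMSEQ_inverse_real_of_nat_add])
    show "\<forall>\<^sub>F j in sequentially. (INF a\<in>S. f a) \<le> f (x j)"
      by (intro always_eventually allI cINF_lower assms(2) x(1))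
    show "\<forall>\<^sub>F j in sequentially. f (x j) \<le> (INF a\<in>S. f a) + inverse (real (Suc j))"
      by (intro always_eventually allI less_imp_le x(2))
  qed
  with x show ?thesis using that by blast
qed

text \<open>The squeeze \<open>a \<le> u j \<le> u j * v j / b\<close>, whose right end tends to
  \<open>a\<close>.\<close>

lemma tendsto_factor_of_tendsto_mult:
  fixes u v :: "'a \<Rightarrow> real"
  assumes "b > 0" "\<And>j. a \<le> u j" "\<And>j. b \<le> v j" "a \<ge> 0"
    and "((\<lambda>j. u j * v j) \<longlongrightarrow> a * b) F"
  shows "(u \<longlongrightarrow> a) F"
proof (rule tendsto_sandwich[OF _ _ tendsto_const])
  show "((\<lambda>j. u j * v j / b) \<longlongrightarrow> a) F"
    using tendsto_divide[OF assms(5) tendsto_const, of b] assms(1) by simp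
  have "u j * b \<le> u j * v j" for j
    using assms(2-4) order_trans by (intro mult_left_mono) blast+
  then show "\<forall>\<^sub>F j in F. u j \<le> u j * v j / b"
    using assms(1) by (intro always_eventually allI) (simp add: pos_le_divide_eq)
qed (use assms(2) in \<open>auto intro: always_eventually\<close>)

text \<open>The preceding squeeze for constant sequences.\<close>

lemma factor_eq_of_mult_eq:
  fixes u v :: real
  assumes "b > 0" "a \<le> u" "b \<le> v" "a \<ge> 0" "u * v = a * b"
  shows "u = a"
  using tendsto_factor_of_tendsto_mult[of b a "\<lambda>_::nat. u" "\<lambda>_. v" sequentially] assms
  by (simp add: LIMSEQ_const_iff)

section \<open>Factorization of ropelength and lower bounds by the infima\<close>

context
  fixes K :: "(real \<Rightarrow> R3) set" and D :: "(real \<Rightarrow> R3) \<Rightarrow> real"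
  assumes D: "geometric_size_functional D"
begin

lemma Rop_eq_rho_mult_CRad:
  assumes "\<gamma> \<in> admissible_reps K"
  shows "Rop \<gamma> = rho D \<gamma> * CRad D \<gamma>"
proof -
  have "D \<gamma> > 0"
    using D assms by (auto simp: geometric_size_functional_def admissible_reps_def)
  then show ?thesis by (simp add: Rop_def rho_def CRad_def)
qed

lemma
  assumes "\<gamma> \<in> admissible_reps K"
  shows Rop_nonneg: "0 \<le> Rop \<gamma>" and rho_nonneg: "0 \<le> rho D \<gamma>" and CRad_nonneg: "0 \<le> CRad D \<gamma>"
proof -
  have "D \<gamma> > 0" "Thi \<gamma> > 0"
    using D assms by (auto simp: geometric_size_functional_def admissible_reps_def admissible_def)
  moreover have "Len \<gamma> \<ge> 0"
    \<comment> \<open>In the non-integrable case \<open>integral\<close> has the default value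
      0.\<close>
    unfolding Len_def by (cases "(\<lambda>t. norm (tangent \<gamma> t)) integrable_on {0..1}")
      (auto intro: integral_nonneg simp: not_integrable_integral)
  ultimately show "0 \<le> Rop \<gamma>" "0 \<le> rho D \<gamma>" "0 \<le> CRad D \<gamma>"
    by (auto simp: Rop_def rho_def CRad_def)
qed

lemma rho_knot_le: "\<gamma> \<in> admissible_reps K \<Longrightarrow> rho_knot D K \<le> rho D \<gamma>"
  unfolding rho_knot_def by (intro cINF_lower bdd_belowI2[where m = 0] rho_nonneg)

lemma CRad_knot_le: "\<gamma> \<in> admissible_reps K \<Longrightarrow> CRad_knot D K \<le> CRad D \<gamma>"
  unfolding CRad_knot_def by (intro cINF_lower bdd_belowI2[where m = 0] CRad_nonneg)

end

theorem proposition3p7: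
  fixes K :: "(real \<Rightarrow> R3) set" and D :: "(real \<Rightarrow> R3) \<Rightarrow> real"
  assumes "knot_type K"
    and "geometric_size_functional D"
    and "rho_knot D K > 0"
    and "CRad_knot D K > 0"
  shows "(Rop_knot K = rho_knot D K * CRad_knot D K \<longleftrightarrow>
           (\<exists>\<gamma> :: nat \<Rightarrow> real \<Rightarrow> R3. (\<forall>j. \<gamma> j \<in> admissible_reps K) \<and>
              (\<lambda>j. Rop (\<gamma> j)) \<longlonglongrightarrow> Rop_knot K \<and>
              (\<lambda>j. rho D (\<gamma> j)) \<longlonglongrightarrow> rho_knot D K \<and>
              (\<lambda>j. CRad D (\<gamma> j)) \<longlonglongrightarrow> CRad_knot D K)) \<and>
         ((\<exists>\<gamma>\<in>admissible_reps K. Rop \<gamma> = Rop_knot K) \<and>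
          (\<exists>\<gamma>\<in>admissible_reps K. rho D \<gamma> = rho_knot D K) \<and>
          (\<exists>\<gamma>\<in>admissible_reps K. CRad D \<gamma> = CRad_knot D K) \<longrightarrow>
          (Rop_knot K = rho_knot D K * CRad_knot D K \<longleftrightarrow>
           (\<exists>\<gamma>\<in>admissible_reps K.
              Rop \<gamma> = Rop_knot K \<and>
              rho D \<gamma> = rho_knot D K \<and>
              CRad D \<gamma> = CRad_knot D K)))"
proof -
  note Rop = Rop_eq_rho_mult_CRad[OF assms(2), of _ K]
    and rho = rho_knot_le[OF assms(2), of _ K] and CRad = CRad_knot_le[OF assms(2), of _ K]
  have "Rop_knot K = rho_knot D K * CRad_knot D K"
    if \<gamma>: "\<forall>j. \<gamma> j \<in> admissible_reps K" and lim: "(\<lambda>j. Rop (\<gamma> j)) \<longlonglongrightarrow> Rop_knot K"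
      "(\<lambda>j. rho D (\<gamma> j)) \<longlonglongrightarrow> rho_knot D K" "(\<lambda>j. CRad D (\<gamma> j)) \<longlonglongrightarrow> CRad_knot D K"
    for \<gamma> :: "nat \<Rightarrow> real \<Rightarrow> R3"
    using tendsto_mult[OF lim(2,3)] lim(1) \<gamma> LIMSEQ_unique by (simp add: Rop)
  moreover have "\<exists>\<gamma> :: nat \<Rightarrow> real \<Rightarrow> R3. (\<forall>j. \<gamma> j \<in> admissible_reps K) \<and>
      (\<lambda>j. Rop (\<gamma> j)) \<longlonglongrightarrow> Rop_knot K \<and> (\<lambda>j. rho D (\<gamma> j)) \<longlonglongrightarrow> rho_knot D K \<and>
      (\<lambda>j. CRad D (\<gamma> j)) \<longlonglongrightarrow> CRad_knot D K"
    if eq: "Rop_knot K = rho_knot D K * CRad_knot D K"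
  proof -
    have "bdd_below (Rop ` admissible_reps K)"
      by (intro bdd_belowI2[where m = 0] Rop_nonneg[OF assms(2)])
    then obtain \<gamma> :: "nat \<Rightarrow> real \<Rightarrow> R3" where \<gamma>: "\<And>j. \<gamma> j \<in> admissible_reps K"
      and lim: "(\<lambda>j. Rop (\<gamma> j)) \<longlonglongrightarrow> Rop_knot K"
      using minimizing_sequence[OF admissible_reps_nonempty[OF assms(1)]]
      unfolding Rop_knot_def by blast
    \<comment> \<open>The assumed equality identifies the limit of the ropelengths with the product
      of the lower bounds, as the squeeze requires.\<close>
    have prod: "(\<lambda>j. rho D (\<gamma> j) * CRad D (\<gamma> j)) \<longlonglongrightarrow> rho_knot D K * CRad_knot D K"
      using lim \<gamma> by (simp add: Rop eq)
    then have "(\<lambda>j. rho D (\<gamma> j)) \<longlonglongrightarrow> rho_knot D K"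
      by (rule tendsto_factor_of_tendsto_mult
          [OF assms(4) rho[OF \<gamma>] CRad[OF \<gamma>] less_imp_le[OF assms(3)]])
    moreover have "(\<lambda>j. CRad D (\<gamma> j)) \<longlonglongrightarrow> CRad_knot D K"
      using prod[unfolded mult.commute[of "rho D _"] mult.commute[of "rho_knot D K"]]
      by (rule tendsto_factor_of_tendsto_mult
          [OF assms(3) CRad[OF \<gamma>] rho[OF \<gamma>] less_imp_le[OF assms(4)]])
    ultimately show ?thesis using \<gamma> lim by blast
  qed
  \<comment> \<open>Under equality, every minimizer of ropelength is a common minimizer.\<close>
  moreover have "rho D \<gamma> = rho_knot D K \<and> CRad D \<gamma> = CRad_knot D K"
    if "Rop_knot K = rho_knot D K * CRad_knot D K" "\<gamma> \<in> admissible_reps K" "Rop \<gamma> = Rop_knot K"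
    for \<gamma>
    using factor_eq_of_mult_eq[of "CRad_knot D K" "rho_knot D K" "rho D \<gamma>" "CRad D \<gamma>"]
      factor_eq_of_mult_eq[of "rho_knot D K" "CRad_knot D K" "CRad D \<gamma>" "rho D \<gamma>"]
      that assms(3,4) Rop[of \<gamma>] rho[of \<gamma>] CRad[of \<gamma>]
    by (simp add: mult.commute)
  \<comment> \<open>Conversely, the factorization evaluated at a common minimizer is the equality of
    the infima.\<close>
  ultimately show ?thesis using Rop by metis
qed

end
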